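(* Let $p$ be a prime. An elementary-abelian $p$-group $V$ is a favorable $p$-group; that is, there is a non-identity automorphism $\phi$ of $V$ of order coprime to $p$ such that for every proper subgroup $H$ of $V$ with $\phi(H)=H$ one has $\phi(h)=h$ for all $h\in H$.
   Context: All groups are finite. A $p'$-automorphism of a $p$-group is an automorphism whose order is coprime to $p$. A $p$-group $G$ is called favorable if there is a non-identity $p'$-automorphism $\phi$ of $G$ such that, whenever $\phi$ fixes (setwise) a proper subgroup $H$ of $G$, it restricts to the identity on $H$.
   Formalization: The formal theorem assumes that V has order greater than 2; the trivial group and the group of order 2 are excluded because they have no non-identity automorphism, so the claim is false for them. *)

theory Defs
  imports "HOL-Algebra.Algebra"
begin

definition p_group :: "nat \<Rightarrow> ('a, 'b) monoid_scheme \<Rightarrow> bool" where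
  "p_group p G \<longleftrightarrow>
     Factorial_Ring.prime p \<and> group G \<and> finite (carrier G) \<and> (\<exists>n::nat. order G = p ^ n)"

definition elementary_abelian :: "nat \<Rightarrow> ('a, 'b) monoid_scheme \<Rightarrow> bool" where
  "elementary_abelian p G \<longleftrightarrow>
     p_group p G \<and> comm_group G \<and> (\<forall>x\<in>carrier G. x [^]\<^bsub>G\<^esub> p = \<one>\<^bsub>G\<^esub>)"

definition p'_automorphism ::
    "nat \<Rightarrow> ('a, 'b) monoid_scheme \<Rightarrow> ('a \<Rightarrow> 'a) \<Rightarrow> bool" where
  "p'_automorphism p G \<phi> \<longleftrightarrow>
     \<phi> \<in> carrier (AutoGroup G) \<and> coprime (group.ord (AutoGroup G) \<phi>) p"

text \<open>Elements of \<^const>\<open>AutoGroup\<close> are extensional on the carrier, so being different from its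
  unit says that the automorphism moves some element of the carrier.\<close>

definition favorable :: "nat \<Rightarrow> ('a, 'b) monoid_scheme \<Rightarrow> bool" where
  "favorable p G \<longleftrightarrow>
     p_group p G \<and>
     (\<exists>\<phi>. p'_automorphism p G \<phi> \<and> \<phi> \<noteq> \<one>\<^bsub>AutoGroup G\<^esub> \<and>
        (\<forall>H. subgroup H G \<and> H \<noteq> carrier G \<and> \<phi> ` H = H \<longrightarrow> (\<forall>h\<in>H. \<phi> h = h)))"

text \<open>Groups of order at most 2 have no non-identity automorphism, so they are never favorable;
  the trivial group and the group of order 2 must be excluded from any claim of favorability.\<close>

lemma favorable_imp_order_gt_2:
  assumes "favorable p G"
  shows "order G > 2"
proof (rule ccontr)
  assume small: "\<not> order G > 2"
  from assms obtain \<phi> where grp: "group G" and fin: "finite (carrier G)"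
    and \<phi>: "\<phi> \<in> hom G G" "\<phi> \<in> Bij (carrier G)" and ne: "\<phi> \<noteq> (\<lambda>x\<in>carrier G. x)"
    by (auto simp: favorable_def p_group_def p'_automorphism_def AutoGroup_def BijGroup_def auto_def)
  interpret group G by (rule grp)
  have one: "\<phi> \<one>\<^bsub>G\<^esub> = \<one>\<^bsub>G\<^esub>"
    using hom_one[OF \<phi>(1) grp grp] .
  have bij: "bij_betw \<phi> (carrier G) (carrier G)" and ext: "\<phi> \<in> extensional (carrier G)"
    using \<phi>(2) by (auto simp: Bij_def)
  have "\<phi> x = x" if x: "x \<in> carrier G" for x
  proof (rule ccontr)
    assume neq: "\<phi> x \<noteq> x"
    then have x1: "x \<noteq> \<one>\<^bsub>G\<^esub>" using one by auto
    have mem: "\<phi> x \<in> carrier G" using bij x by (auto simp: bij_betw_def)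
    have "\<phi> x \<noteq> \<one>\<^bsub>G\<^esub>"
      using bij x x1 one by (metis bij_betw_def inj_onD one_closed)
    then have "card {\<one>\<^bsub>G\<^esub>, x, \<phi> x} = 3" using neq x1 by auto
    moreover have "card {\<one>\<^bsub>G\<^esub>, x, \<phi> x} \<le> card (carrier G)"
      by (rule card_mono) (use fin x mem in auto)
    ultimately show False using small by (simp add: order_def)
  qed
  then have "\<phi> = (\<lambda>x\<in>carrier G. x)"
    using ext by (auto simp: fun_eq_iff extensional_def)
  with ne show False ..
qed

end

theory Submission
  imports Defs "HOL-Number_Theory.Residues"
begin

text \<open>Let \<open>V\<close> have order \<open>q = p\<^sup>n > 2\<close>. It is isomorphic to the additive group of a field \<open>K\<close> with
  \<open>q\<close> elements, since both are elementary abelian. Multiplication by a generator of the cyclic group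
  \<open>K - {0}\<close> (a Singer cycle) becomes an automorphism of \<open>V\<close> whose order divides \<open>q - 1\<close> and which is
  transitive on the non-identity elements, so that its only invariant proper subgroup is the
  trivial one. The field \<open>K\<close> consists of the roots of \<open>X\<^sup>q - X\<close> in an algebraic closure of the
  field with \<open>p\<close> elements.\<close>

subsection \<open>Frobenius maps\<close>

text \<open>Induction on \<open>n\<close>: multiplying the expansion by \<open>x\<close> shifts the
  index of the terms \<open>t\<close>, multiplying by \<open>y\<close> keeps it, and Pascal's rule
  merges the two sums.\<close>

lemma (in cring) binomial_theorem:
  assumes x: "x \<in> carrier R" and y: "y \<in> carrier R"
  shows "(x \<oplus> y) [^] n = (\<Oplus>k\<in>{..n}. add_pow R (n choose k) (x [^] k \<otimes> y [^] (n - k)))"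
proof (induction n)
  case 0
  then show ?case by simp
next
  case (Suc n)
  define t where "t k = x [^] k \<otimes> y [^] (Suc n - k)" for k
  have t: "t k \<in> carrier R" for k using x y by (simp add: t_def)
  have x1: "(add_pow R (n choose k) (x [^] k \<otimes> y [^] (n - k))) \<otimes> x = add_pow R (n choose k) (t (Suc k))" for k
    using x y by (simp add: t_def add_pow_ldistr m_ac add_pow_rdistr)
  have y1: "(add_pow R (n choose k) (x [^] k \<otimes> y [^] (n - k))) \<otimes> y = add_pow R (n choose k) (t k)" if "k \<le> n" for k
    using x y that by (simp add: t_def add_pow_ldistr m_assoc Suc_diff_le)
  have "(x \<oplus> y) [^] Suc n = (\<Oplus>k\<in>{..n}. add_pow R (n choose k) (x [^] k \<otimes> y [^] (n - k))) \<otimes> x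
     \<oplus> (\<Oplus>k\<in>{..n}. add_pow R (n choose k) (x [^] k \<otimes> y [^] (n - k))) \<otimes> y"
    using x y by (simp add: Suc.IH r_distr)
  also have "\<dots> = (\<Oplus>k\<in>{..n}. add_pow R (n choose k) (t (Suc k))) \<oplus> (\<Oplus>k\<in>{..n}. add_pow R (n choose k) (t k))"
    using x y t by (subst (1 2) finsum_ldistr) (auto simp: x1 y1 intro!: arg_cong2[where f = "(\<oplus>)"] add.finprod_cong')
  \<comment> \<open>The extra term has coefficient \<open>n choose Suc n = 0\<close>; once the range
    is longer, splitting off index 0 leaves a sum with the same index set as the other one.\<close>
  also have "(\<Oplus>k\<in>{..n}. add_pow R (n choose k) (t k)) = (\<Oplus>k\<in>{..Suc n}. add_pow R (n choose k) (t k))"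
    using t by (simp add: Pi_def binomial_eq_0)
  also have "\<dots> = (\<Oplus>k\<in>{..n}. add_pow R (n choose Suc k) (t (Suc k))) \<oplus> t 0"
    using t by (subst finsum_Suc2) (auto simp: Pi_def)
  also have "(\<Oplus>k\<in>{..n}. add_pow R (n choose k) (t (Suc k))) \<oplus> \<dots> =
     (\<Oplus>k\<in>{..n}. add_pow R (n choose k) (t (Suc k)) \<oplus> add_pow R (n choose Suc k) (t (Suc k))) \<oplus> t 0"
    using t by (subst finsum_addf) (auto simp: Pi_def a_assoc)
  also have "\<dots> = (\<Oplus>k\<in>{..n}. add_pow R (Suc n choose Suc k) (t (Suc k))) \<oplus> t 0"
    using t by (simp add: add.nat_pow_mult)
  also have "\<dots> = (\<Oplus>k\<in>{..Suc n}. add_pow R (Suc n choose k) (t k))"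
    using t by (subst finsum_Suc2) (auto simp: Pi_def)
  finally show ?case by (simp add: t_def)
qed

lemma (in cring) add_pow_char_eq_zero:
  assumes "add_pow R (p::nat) \<one> = \<zero>" "p dvd m" "x \<in> carrier R"
  shows "add_pow R m x = \<zero>"
proof -
  from \<open>p dvd m\<close> obtain k where "m = p * k" ..
  moreover have "add_pow R p x = \<zero>"
    using add_pow_ldistr[of \<one> x p] assms by simp
  ultimately show ?thesis
    using assms(3) by (simp flip: add.nat_pow_pow)
qed

text \<open>For \<open>n = 1\<close> the inner binomial coefficients \<open>p choose k\<close> are
  divisible by \<open>p\<close> and so kill their terms in characteristic \<open>p\<close>.
  Iterating gives all powers \<open>p ^ n\<close>.\<close>

lemma (in cring) frobenius_add:
  assumes p: "Factorial_Ring.prime p" and char: "add_pow R (p::nat) \<one> = \<zero>"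
    and x: "x \<in> carrier R" and y: "y \<in> carrier R"
  shows "(x \<oplus> y) [^] (p ^ n) = x [^] (p ^ n) \<oplus> y [^] (p ^ n)"
proof -
  have step: "(x \<oplus> y) [^] p = x [^] p \<oplus> y [^] p" if x: "x \<in> carrier R" and y: "y \<in> carrier R" for x y
  proof -
    \<comment> \<open>With \<open>p = m + 2\<close> the inner indices 1, ..., \<open>p - 1\<close>
      are exactly the \<open>Suc k\<close> with \<open>k \<le> m\<close>, and the two outer terms
      can be split off.\<close>
    obtain m where m: "p = Suc (Suc m)"
      using prime_ge_2_nat[OF p] by (metis add_2_eq_Suc le_Suc_ex)
    define c where "c k = add_pow R (p choose k) (x [^] k \<otimes> y [^] (p - k))" for k
    have c: "c k \<in> carrier R" for k using x y by (simp add: c_def)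
    have "c (Suc k) = \<zero>" if "k \<le> m" for k
      unfolding c_def
      by (rule add_pow_char_eq_zero[OF char])
        (use that x y m p in \<open>auto intro!: dvd_choose_prime simp del: binomial_Suc_Suc\<close>)
    then have "(\<Oplus>k\<in>{..m}. c (Suc k)) = \<zero>"
      by (intro add.finprod_one_eqI) auto
    moreover have "(x \<oplus> y) [^] p = (\<Oplus>k\<in>{..Suc (Suc m)}. c k)"
      unfolding binomial_theorem[OF x y] c_def m ..
    moreover have "(\<Oplus>k\<in>{..Suc (Suc m)}. c k) = c p \<oplus> ((\<Oplus>k\<in>{..m}. c (Suc k)) \<oplus> c 0)"
      using c by (subst finsum_Suc, simp, subst finsum_Suc2) (simp_all add: m)
    ultimately show ?thesis
      using x y c[of 0] c[of p] by (simp add: c_def)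
  qed
  show ?thesis
  proof (induction n)
    case (Suc n)
    then show ?case
      using x y step by (simp add: mult.commute[of p] flip: nat_pow_pow)
  qed (use x y in simp)
qed

text \<open>Additivity applied to \<open>(x \<ominus> y) \<oplus> y\<close> avoids computing the
  sign (-1)^(p^n), which would single out \<open>p = 2\<close>.\<close>

lemma (in cring) frobenius_minus:
  assumes p: "Factorial_Ring.prime p" and char: "add_pow R (p::nat) \<one> = \<zero>"
    and x: "x \<in> carrier R" and y: "y \<in> carrier R"
  shows "(x \<ominus> y) [^] (p ^ n) = x [^] (p ^ n) \<ominus> y [^] (p ^ n)"
proof -
  have "x [^] (p ^ n) = ((x \<ominus> y) \<oplus> y) [^] (p ^ n)"
    using x y by (simp add: minus_eq a_assoc l_neg)
  also have "\<dots> = (x \<ominus> y) [^] (p ^ n) \<oplus> y [^] (p ^ n)"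
    using x y by (intro frobenius_add[OF p char]) auto
  finally show ?thesis
    using x y by (simp add: a_minus_def a_assoc r_neg)
qed

subsection \<open>Finite fields\<close>

text \<open>The embedding of constants is a ring homomorphism and carries the relation over, so that
  the Frobenius identities also apply to polynomials.\<close>

lemma (in domain) char_poly_ring:
  assumes "add_pow R (p::nat) \<one> = \<zero>"
  shows "add_pow (poly_ring R) p \<one>\<^bsub>poly_ring R\<^esub> = \<zero>\<^bsub>poly_ring R\<^esub>"
proof -
  interpret P: domain "poly_ring R"
    using univ_poly_is_domain[OF carrier_is_subring] .
  interpret c: ring_hom_ring R "poly_ring R" poly_of_const
    using canonical_embedding_ring_hom[OF carrier_is_subring] by simp
  interpret c: group_hom "add_monoid R" "add_monoid (poly_ring R)" poly_of_const
    by (rule c.a_group_hom)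
  show ?thesis
    using c.hom_nat_pow[of \<one> p] assms c.hom_zero c.hom_one by (simp add: add_pow_def)
qed

text \<open>Every root \<open>a\<close> satisfies \<open>X\<^sup>q - X = (X - a)\<^sup>q - (X - a)\<close> with \<open>q = p\<^sup>n\<close>, and
  cancelling \<open>X - a\<close> leaves a polynomial with value \<open>-1\<close> at \<open>a\<close>.\<close>

lemma (in domain) frobenius_poly_roots_simple:
  assumes p: "Factorial_Ring.prime p" and char: "add_pow R (p::nat) \<one> = \<zero>" and q: "1 < p ^ n"
    and a: "a \<in> carrier R" "a [^] (p ^ n) = a"
  shows "\<not> ([\<one>, \<ominus> a] [^]\<^bsub>poly_ring R\<^esub> (2::nat))
            pdivides (X [^]\<^bsub>poly_ring R\<^esub> (p ^ n) \<ominus>\<^bsub>poly_ring R\<^esub> X)"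
proof
  let ?P = "poly_ring R"
  interpret P: domain ?P
    using univ_poly_is_domain[OF carrier_is_subring] .
  interpret c: ring_hom_ring R ?P poly_of_const
    using canonical_embedding_ring_hom[OF carrier_is_subring] by simp
  interpret ev: ring_hom_ring ?P R "\<lambda>f. eval f a"
    using eval_ring_hom[OF carrier_is_subring a(1)] .
  define A where "A = [\<one>, \<ominus> a]"
  define c where "c = poly_of_const a"
  have X: "X \<in> carrier ?P" and c: "c \<in> carrier ?P"
    using var_closed(1)[OF carrier_is_subring] c.hom_closed[OF a(1)] by (auto simp: c_def)
  have A: "A \<in> carrier ?P"
    using a by (simp add: A_def univ_poly_carrier[symmetric] polynomial_def)
  have A_eq: "A = X \<ominus>\<^bsub>?P\<^esub> c"
  proof -
    have "X \<ominus>\<^bsub>?P\<^esub> c = X \<oplus>\<^bsub>?P\<^esub> poly_of_const (\<ominus> a)"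
      using a by (simp add: a_minus_def c_def)
    also have "\<dots> = A"
      using a by (auto simp: A_def univ_poly_add poly_of_const_def var_def)
    finally show ?thesis ..
  qed
  \<comment> \<open>The root property of \<open>a\<close> enters here: the constant polynomial
    \<open>c\<close> is fixed by the Frobenius power.\<close>
  have cq: "c [^]\<^bsub>?P\<^esub> (p ^ n) = c"
    unfolding c_def using a by (simp flip: c.hom_nat_pow)
  have eq: "X [^]\<^bsub>?P\<^esub> (p ^ n) \<ominus>\<^bsub>?P\<^esub> X = A [^]\<^bsub>?P\<^esub> (p ^ n) \<ominus>\<^bsub>?P\<^esub> A"
  proof -
    have "A [^]\<^bsub>?P\<^esub> (p ^ n) = X [^]\<^bsub>?P\<^esub> (p ^ n) \<ominus>\<^bsub>?P\<^esub> c"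
      unfolding A_eq using P.frobenius_minus[OF p char_poly_ring[OF char] X c] by (simp add: cq)
    moreover have "u \<ominus>\<^bsub>?P\<^esub> v = (u \<ominus>\<^bsub>?P\<^esub> w) \<ominus>\<^bsub>?P\<^esub> (v \<ominus>\<^bsub>?P\<^esub> w)"
      if "u \<in> carrier ?P" "v \<in> carrier ?P" "w \<in> carrier ?P" for u v w
      using that by algebra
    ultimately show ?thesis
      using X c A_eq by (metis P.nat_pow_closed)
  qed
  have A0: "A \<noteq> \<zero>\<^bsub>?P\<^esub>" by (simp add: A_def univ_poly_zero)
  have evA: "eval A a = \<zero>" using a by (simp add: A_def r_neg)
  \<comment> \<open>After one factor \<open>A\<close> is cancelled, the exponent
    \<open>Suc m\<close> that remains is still positive, so that power of \<open>A\<close> vanishes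
    at \<open>a\<close>.\<close>
  obtain m where m: "p ^ n = Suc (Suc m)"
    using q that[of "p ^ n - 2"] by linarith
  assume "([\<one>, \<ominus> a] [^]\<^bsub>?P\<^esub> (2::nat)) pdivides (X [^]\<^bsub>?P\<^esub> (p ^ n) \<ominus>\<^bsub>?P\<^esub> X)"
  then obtain g where g: "g \<in> carrier ?P"
    and "A [^]\<^bsub>?P\<^esub> (p ^ n) \<ominus>\<^bsub>?P\<^esub> A = (A [^]\<^bsub>?P\<^esub> (2::nat)) \<otimes>\<^bsub>?P\<^esub> g"
    unfolding pdivides_def factor_def A_def[symmetric] eq by auto
  then have "(A [^]\<^bsub>?P\<^esub> Suc m \<otimes>\<^bsub>?P\<^esub> A) \<ominus>\<^bsub>?P\<^esub> A = (A \<otimes>\<^bsub>?P\<^esub> A) \<otimes>\<^bsub>?P\<^esub> g"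
    using A by (simp add: m numeral_2_eq_2)
  moreover have "(u \<otimes>\<^bsub>?P\<^esub> A) \<ominus>\<^bsub>?P\<^esub> A = A \<otimes>\<^bsub>?P\<^esub> (u \<ominus>\<^bsub>?P\<^esub> \<one>\<^bsub>?P\<^esub>)" if "u \<in> carrier ?P" for u
    using that A by (simp add: a_minus_def P.r_distr P.r_minus P.m_comm)
  ultimately have "A \<otimes>\<^bsub>?P\<^esub> (A [^]\<^bsub>?P\<^esub> Suc m \<ominus>\<^bsub>?P\<^esub> \<one>\<^bsub>?P\<^esub>) = A \<otimes>\<^bsub>?P\<^esub> (A \<otimes>\<^bsub>?P\<^esub> g)"
    using A g by (metis P.m_assoc P.nat_pow_closed)
  then have "A [^]\<^bsub>?P\<^esub> Suc m \<ominus>\<^bsub>?P\<^esub> \<one>\<^bsub>?P\<^esub> = A \<otimes>\<^bsub>?P\<^esub> g"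
    by (simp only: P.m_lcancel[OF A0 A P.minus_closed[OF P.nat_pow_closed[OF A] P.one_closed] P.m_closed[OF A g]])
  then have "eval (A [^]\<^bsub>?P\<^esub> Suc m \<ominus>\<^bsub>?P\<^esub> \<one>\<^bsub>?P\<^esub>) a = eval (A \<otimes>\<^bsub>?P\<^esub> g) a" by simp
  moreover have "eval (A [^]\<^bsub>?P\<^esub> Suc m \<ominus>\<^bsub>?P\<^esub> \<one>\<^bsub>?P\<^esub>) a = eval A a [^] Suc m \<ominus> \<one>"
    unfolding a_minus_def using A
    by (simp only: ev.hom_add ev.hom_a_inv ev.hom_nat_pow ev.hom_one P.nat_pow_closed P.one_closed P.a_inv_closed)
  moreover have "eval (A \<otimes>\<^bsub>?P\<^esub> g) a = eval A a \<otimes> eval g a"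
    using A g by (rule ev.hom_mult)
  ultimately have "\<ominus> \<one> = \<zero>"
    using ev.hom_closed[OF g] by (simp add: evA a_minus_def)
  then show False
    using one_not_zero by (metis minus_minus minus_zero one_closed)
qed

text \<open>The fixed elements are the roots of X^q - X with q = p^n. This polynomial has degree q,
  splits over \<open>L\<close>, and has only simple roots, so there are q distinct ones.\<close>

lemma (in algebraically_closed) card_frobenius_fixed:
  assumes p: "Factorial_Ring.prime p" and char: "add_pow L (p::nat) \<one> = \<zero>" and q: "1 < p ^ n"
  shows "card {x \<in> carrier L. x [^] (p ^ n) = x} = p ^ n"
proof -
  let ?P = "poly_ring L"
  interpret P: domain ?P
    using univ_poly_is_domain[OF carrier_is_subring] .
  define f where "f = X [^]\<^bsub>?P\<^esub> (p ^ n) \<ominus>\<^bsub>?P\<^esub> X"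
  have X: "X \<in> carrier ?P"
    using var_closed(1)[OF carrier_is_subring] .
  have f: "f \<in> carrier ?P" using X by (simp add: f_def)
  have deg: "degree f = p ^ n"
  proof -
    have "degree (\<ominus>\<^bsub>?P\<^esub> X) = 1"
      using univ_poly_a_inv_degree[OF carrier_is_subring X] by (simp add: var_def)
    moreover have "degree (X [^]\<^bsub>?P\<^esub> (p ^ n)) = p ^ n"
      using polynomial_pow_degree[OF X] by (simp add: var_def)
    moreover have "polynomial (carrier L) (X [^]\<^bsub>?P\<^esub> (p ^ n))" "polynomial (carrier L) (\<ominus>\<^bsub>?P\<^esub> X)"
      using X by (simp_all only: univ_poly_carrier P.nat_pow_closed P.a_inv_closed)
    moreover have "f = poly_add (X [^]\<^bsub>?P\<^esub> (p ^ n)) (\<ominus>\<^bsub>?P\<^esub> X)"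
      by (simp only: f_def a_minus_def univ_poly_add)
    moreover have "p ^ n \<noteq> 1" "max (p ^ n) 1 = p ^ n"
      using q by linarith+
    ultimately show ?thesis
      using poly_add_degree_eq[OF carrier_is_subring] by metis
  qed
  have f0: "f \<noteq> []"
    using deg q by (metis diff_0_eq_0 list.size(3) not_less_zero)
  have root: "is_root f x \<longleftrightarrow> x \<in> carrier L \<and> x [^] (p ^ n) = x" for x
  proof (cases "x \<in> carrier L")
    case True
    interpret ev: ring_hom_ring ?P L "\<lambda>f. eval f x"
      using eval_ring_hom[OF carrier_is_subring True] .
    have "eval f x = x [^] (p ^ n) \<ominus> x"
      using X True by (simp add: f_def a_minus_def ev.hom_add ev.hom_a_inv ev.hom_nat_pow eval_var)
    then show ?thesis
      using True f0 by (simp add: is_root_def)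
  qed (simp add: is_root_def)
  have "count (roots f) x \<le> 1" for x
  proof (rule ccontr)
    assume "\<not> count (roots f) x \<le> 1"
    then have *: "2 \<le> alg_mult f x"
      by (simp add: alg_mult_eq_count_roots[OF f])
    then have "is_root f x"
      using alg_mult_gt_zero_iff_is_root[OF f, of x] by simp
    then have x: "x \<in> carrier L" "x [^] (p ^ n) = x" by (auto simp: root)
    show False
      using frobenius_poly_roots_simple[OF p char q x] le_alg_mult_imp_pdivides[OF x(1) f *]
      by (simp add: f_def)
  qed
  \<comment> \<open>Multiplicities at most 1 make the multiset of roots a set, so its size counts
    distinct roots.\<close>
  then have "count (roots f) x = count (mset_set (set_mset (roots f))) x" for x
    by (metis count_eq_zero_iff count_mset_set(1,3) finite_set_mset le_neq_implies_less less_one)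
  then have "size (roots f) = card (set_mset (roots f))"
    by (metis multiset_eqI size_mset_set)
  moreover have "set_mset (roots f) = {x \<in> carrier L. x [^] (p ^ n) = x}"
    using roots_mem_iff_is_root[OF f] root by auto
  moreover have "size (roots f) = p ^ n"
    using roots_over_carrier[OF f] deg by (simp add: splitted_def)
  ultimately show ?thesis by simp
qed

text \<open>The Frobenius power respects sums and products, and negatives are differences from
  \<open>\<zero>\<close>. For inverses, \<open>(inv k) [^] (p ^ n)\<close> is again an inverse of
  \<open>k\<close>, hence equal to \<open>inv k\<close>.\<close>

lemma (in field) subfield_frobenius_fixed:
  assumes p: "Factorial_Ring.prime p" and char: "add_pow R (p::nat) \<one> = \<zero>"
  shows "subfield {x \<in> carrier R. x [^] (p ^ n) = x} R"
proof (rule subfieldI'[OF subringI])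
  have "p ^ n \<noteq> 0" using p by (simp add: prime_gt_0_nat)
  then have z: "\<zero> [^] (p ^ n) = \<zero>" by (metis Suc_pred gr_zeroI nat_pow_Suc nat_pow_closed r_null zero_closed)
  show "\<ominus> h \<in> {x \<in> carrier R. x [^] (p ^ n) = x}" if "h \<in> {x \<in> carrier R. x [^] (p ^ n) = x}" for h
    using that frobenius_minus[OF p char zero_closed, of h n] z by (simp add: a_minus_def)
  show "inv k \<in> {x \<in> carrier R. x [^] (p ^ n) = x}"
    if "k \<in> {x \<in> carrier R. x [^] (p ^ n) = x} - {\<zero>}" for k
  proof -
    have k: "k \<in> Units R" "k \<in> carrier R" "k [^] (p ^ n) = k"
      using that field_Units by auto
    then have "k \<otimes> (inv k) [^] (p ^ n) = (k \<otimes> inv k) [^] (p ^ n)"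
      by (subst nat_pow_distrib) auto
    also have "\<dots> = \<one>" using k by simp
    finally show ?thesis
      using comm_inv_char[of k "(inv k) [^] (p ^ n)"] k by auto
  qed
qed (auto simp: frobenius_add[OF p char] nat_pow_distrib)

text \<open>In the additive group, which has order \<open>p\<close>, every element is annihilated by
  the group order.\<close>

lemma residue_ring_char:
  assumes "1 < (p::nat)"
  shows "add_pow (residue_ring (int p)) p \<one>\<^bsub>residue_ring (int p)\<^esub> = \<zero>\<^bsub>residue_ring (int p)\<^esub>"
proof -
  interpret residues "int p" "residue_ring (int p)"
    using assms by unfold_locales auto
  have "order (add_monoid (residue_ring (int p))) = p"
    by (simp add: order_def res_carrier_eq)
  then show ?thesis
    using add.pow_order_eq_1[of "\<one>\<^bsub>residue_ring (int p)\<^esub>"] by (simp add: add_pow_def)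
qed

text \<open>The witness is the set of Frobenius-fixed elements in an algebraic closure of the
  residue field. The element type is the one that \<open>exists_closure\<close> yields for a base
  field over \<open>int\<close>.\<close>

lemma exists_field_of_prime_power_order:
  assumes p: "Factorial_Ring.prime p" and n: "1 < p ^ n"
  shows "\<exists>F :: ((int list \<times> nat) multiset \<Rightarrow> int) ring.
    field F \<and> order F = p ^ n \<and> add_pow F (p::nat) \<one>\<^bsub>F\<^esub> = \<zero>\<^bsub>F\<^esub>"
proof -
  let ?R = "residue_ring (int p)"
  interpret R: residues_prime p ?R
    using p by (rule residues_prime.intro)
  obtain L :: "((int list \<times> nat) multiset \<Rightarrow> int) ring"
    where L: "algebraic_closure L (R.indexed_const ` carrier ?R)"
      and hom: "R.indexed_const \<in> ring_hom ?R L"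
    by (rule R.exists_closure)
  interpret L: algebraic_closure L "R.indexed_const ` carrier ?R" by (rule L)
  interpret h: ring_hom_ring ?R L R.indexed_const
    using hom by (intro ring_hom_ringI2 R.ring_axioms L.ring_axioms)
  interpret h: group_hom "add_monoid ?R" "add_monoid L" R.indexed_const
    by (rule h.a_group_hom)
  have char: "add_pow L p \<one>\<^bsub>L\<^esub> = \<zero>\<^bsub>L\<^esub>"
    using h.hom_nat_pow[of "\<one>\<^bsub>?R\<^esub>" p] residue_ring_char[OF prime_gt_1_nat[OF p]] h.hom_zero h.hom_one
    by (simp add: add_pow_def)
  define K where "K = {x \<in> carrier L. x [^]\<^bsub>L\<^esub> (p ^ n) = x}"
  have "subfield K L"
    unfolding K_def by (rule L.subfield_frobenius_fixed[OF p char])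
  then have "field (L\<lparr>carrier := K\<rparr>)"
    by (rule L.subfield_iff(2))
  moreover have "order (L\<lparr>carrier := K\<rparr>) = p ^ n"
    using L.card_frobenius_fixed[OF p char n] by (simp add: order_def K_def)
  \<comment> \<open>Multiples are computed from the addition and zero of \<open>L\<close> alone, so
    shrinking the carrier does not change them.\<close>
  moreover have "add_pow (L\<lparr>carrier := K\<rparr>) p \<one>\<^bsub>L\<^esub> = \<zero>\<^bsub>L\<^esub>"
    using char by (simp add: add_pow_def nat_pow_def)
  ultimately show ?thesis by (intro exI[of _ "L\<lparr>carrier := K\<rparr>"]) simp
qed

subsection \<open>Elementary abelian groups\<close>

lemma hom_restrict_carrier: "h \<in> hom G K \<Longrightarrow> A \<subseteq> carrier G \<Longrightarrow> h \<in> hom (G\<lparr>carrier := A\<rparr>) K"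
  by (auto simp: hom_def)

text \<open>By Bezout, \<open>x\<close> is a power of \<open>x [^] i\<close> times a power of
  \<open>x [^] p\<close>, and the latter is trivial.\<close>

lemma (in comm_group) coprime_pow_mem:
  assumes A: "subgroup A G" and x: "x \<in> carrier G" and i: "x [^] (i::int) \<in> A"
    and p: "x [^] (p::int) = \<one>" and "coprime i p"
  shows "x \<in> A"
proof -
  obtain u v where "u * i + v * p = 1"
    using bezout_int[of i p] \<open>coprime i p\<close> by auto
  then have "x = x [^] (u * i + v * p)"
    using x by simp
  also have "\<dots> = (x [^] i) [^] u \<otimes> (x [^] p) [^] v"
    using x by (simp add: int_pow_mult int_pow_pow mult.commute)
  also have "\<dots> = (x [^] i) [^] u"
    using x p by simp
  also have "\<dots> \<in> A"
    using group.int_pow_closed[OF subgroup_imp_group[OF A]] i int_pow_consistent[OF A i] by auto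
  finally show ?thesis .
qed

text \<open>Instead of comparing bases, a partial isomorphism is extended until it is total. Its
  graph is a subgroup of the product; a maximal graph must project onto both factors, since
  otherwise a pair of missed elements could be adjoined.\<close>

lemma elementary_abelian_iso:
  fixes G :: "('a, 'c) monoid_scheme" and H :: "('b, 'd) monoid_scheme"
  assumes G: "elementary_abelian p G" and H: "elementary_abelian p H" and ord: "order G = order H"
  shows "G \<cong> H"
proof -
  have p: "Factorial_Ring.prime p" and finG: "finite (carrier G)" and finH: "finite (carrier H)"
    and cG: "comm_group G" and cH: "comm_group H"
    and pG: "\<And>x. x \<in> carrier G \<Longrightarrow> x [^]\<^bsub>G\<^esub> p = \<one>\<^bsub>G\<^esub>"
    and pH: "\<And>x. x \<in> carrier H \<Longrightarrow> x [^]\<^bsub>H\<^esub> p = \<one>\<^bsub>H\<^esub>"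
    using G H by (auto simp: elementary_abelian_def p_group_def)
  interpret G: comm_group G by (rule cG)
  interpret H: comm_group H by (rule cH)
  let ?P = "G \<times>\<times> H"
  interpret P: comm_group ?P
    by (auto intro!: comm_group.intro comm_monoidI DirProd_group G.is_group H.is_group group.is_monoid simp: G.m_ac H.m_ac)
  have [simp]: "\<one>\<^bsub>?P\<^esub> = (\<one>\<^bsub>G\<^esub>, \<one>\<^bsub>H\<^esub>)" by simp
  have fst_hom: "group_hom ?P G fst" and snd_hom: "group_hom ?P H snd"
    by (unfold_locales) (auto simp: hom_def)
  interpret fst: group_hom ?P G fst by (rule fst_hom)
  interpret snd: group_hom ?P H snd by (rule snd_hom)
  \<comment> \<open>graphs of partial isomorphisms: subgroups of the product meeting both factors trivially\<close>
  define graph where "graph R \<longleftrightarrow> subgroup R ?P \<and> (\<forall>(a, b)\<in>R. a = \<one>\<^bsub>G\<^esub> \<longleftrightarrow> b = \<one>\<^bsub>H\<^esub>)" for R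
  have graph_triv: "graph {\<one>\<^bsub>?P\<^esub>}"
    unfolding graph_def using P.triv_subgroup by auto
  have fin: "finite {R. graph R}"
  proof (rule finite_subset)
    show "{R. graph R} \<subseteq> Pow (carrier ?P)"
      using subgroup.subset[of _ ?P] unfolding graph_def by blast
  qed (use finG finH in simp)
  then obtain R where R: "graph R" and max: "\<And>R'. graph R' \<Longrightarrow> \<not> R \<subset> R'"
    using graph_triv finite_has_maximal[of "{R. graph R}"] by fastforce
  have sub: "subgroup R ?P" and one_iff: "\<And>z. z \<in> R \<Longrightarrow> fst z = \<one>\<^bsub>G\<^esub> \<longleftrightarrow> snd z = \<one>\<^bsub>H\<^esub>"
    using R by (auto simp: graph_def)
  interpret R: subgroup R ?P by (rule sub)
  interpret RG: group "?P\<lparr>carrier := R\<rparr>" by (rule P.subgroup_imp_group[OF sub])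
  have fstR: "group_hom (?P\<lparr>carrier := R\<rparr>) G fst" and sndR: "group_hom (?P\<lparr>carrier := R\<rparr>) H snd"
    using hom_restrict_carrier[OF fst.homh R.subset] hom_restrict_carrier[OF snd.homh R.subset]
      RG.is_group G.is_group H.is_group
    by (simp_all only: group_hom_def group_hom_axioms_def)
  have inj: "inj_on fst R" "inj_on snd R"
    using group_hom.inj_iff_trivial_ker[OF fstR] group_hom.inj_iff_trivial_ker[OF sndR]
      one_iff R.one_closed by (auto simp: kernel_def)
  have surj: "fst ` R = carrier G \<and> snd ` R = carrier H"
  proof (rule ccontr)
    assume not: "\<not> ?thesis"
    have le: "fst ` R \<subseteq> carrier G" "snd ` R \<subseteq> carrier H"
      using R.subset by auto
    \<comment> \<open>Both projections are injective on \<open>R\<close> and the groups have equal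
      order, so failing to cover one factor means failing to cover both.\<close>
    have "card (fst ` R) = card (snd ` R)"
      using inj by (simp add: card_image)
    then have "fst ` R \<noteq> carrier G" "snd ` R \<noteq> carrier H"
      using not ord card_subset_eq[OF finG le(1)] card_subset_eq[OF finH le(2)] unfolding order_def by metis+
    then obtain x y where x: "x \<in> carrier G" "x \<notin> fst ` R" and y: "y \<in> carrier H" "y \<notin> snd ` R"
      using le by blast
    define z where "z = (x, y)"
    have z: "z \<in> carrier ?P" using x y by (simp add: z_def)
    \<comment> \<open>The extended graph is to send \<open>x\<close> to \<open>y\<close>; it remains
      to see that it still meets both factors trivially.\<close>
    define R' where "R' = R <#>\<^bsub>?P\<^esub> generate ?P {z}"
    have gen: "subgroup (generate ?P {z}) ?P"
      using z by (intro P.generate_is_subgroup) auto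
    have sub': "subgroup R' ?P"
      unfolding R'_def by (rule P.mult_subgroups[OF sub gen])
    have sf: "subgroup (fst ` R) G" and ss: "subgroup (snd ` R) H"
      using fst.subgroup_img_is_subgroup[OF sub] snd.subgroup_img_is_subgroup[OF sub] by auto
    have "fst w = \<one>\<^bsub>G\<^esub> \<longleftrightarrow> snd w = \<one>\<^bsub>H\<^esub>" if "w \<in> R'" for w
    proof -
      obtain r i where r: "r \<in> R" and w: "w = r \<otimes>\<^bsub>?P\<^esub> z [^]\<^bsub>?P\<^esub> (i::int)"
      proof -
        obtain r h where "r \<in> R" "h \<in> generate ?P {z}" "w = r \<otimes>\<^bsub>?P\<^esub> h"
          using \<open>w \<in> R'\<close> unfolding R'_def set_mult_def by blast
        then show ?thesis
          using that unfolding P.generate_pow[OF z] by blast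
      qed
      have rP: "r \<in> carrier ?P" using r R.subset by auto
      have zi: "z [^]\<^bsub>?P\<^esub> i \<in> carrier ?P" using z by (rule P.int_pow_closed)
      have fw: "fst w = fst r \<otimes>\<^bsub>G\<^esub> x [^]\<^bsub>G\<^esub> i" and sw: "snd w = snd r \<otimes>\<^bsub>H\<^esub> y [^]\<^bsub>H\<^esub> i"
        unfolding w fst.hom_mult[OF rP zi] snd.hom_mult[OF rP zi] fst.hom_int_pow[OF z] snd.hom_int_pow[OF z]
        by (simp_all add: z_def)
      have zp: "x [^]\<^bsub>G\<^esub> int p = \<one>\<^bsub>G\<^esub>" "y [^]\<^bsub>H\<^esub> int p = \<one>\<^bsub>H\<^esub>"
        using x y pG pH by (simp_all add: int_pow_int)
      show ?thesis
      \<comment> \<open>If \<open>p\<close> divides \<open>i\<close>, the power of \<open>z\<close>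
        is trivial and \<open>w = r\<close>. Otherwise neither coordinate of \<open>w\<close> is
        trivial: a trivial one would put \<open>x [^] i\<close> or \<open>y [^] i\<close>, hence
        \<open>x\<close> or \<open>y\<close> itself, into a projection of \<open>R\<close>.\<close>
      proof (cases "int p dvd i")
        case True
        then obtain k where "i = int p * k" ..
        then have "x [^]\<^bsub>G\<^esub> i = \<one>\<^bsub>G\<^esub>" "y [^]\<^bsub>H\<^esub> i = \<one>\<^bsub>H\<^esub>"
          using x y zp by (simp_all flip: G.int_pow_pow H.int_pow_pow)
        then show ?thesis
          using fw sw rP one_iff[OF r] by auto
      next
        case False
        then have cop: "coprime i (int p)"
          using p by (subst coprime_commute) (auto intro!: prime_imp_coprime)
        have "x [^]\<^bsub>G\<^esub> i \<notin> fst ` R"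
          using G.coprime_pow_mem[OF sf _ _ zp(1) cop] x by blast
        moreover have "y [^]\<^bsub>H\<^esub> i \<notin> snd ` R"
          using H.coprime_pow_mem[OF ss _ _ zp(2) cop] y by blast
        moreover have "x [^]\<^bsub>G\<^esub> i \<in> fst ` R" if "fst w = \<one>\<^bsub>G\<^esub>"
        proof -
          have "x [^]\<^bsub>G\<^esub> i = inv\<^bsub>G\<^esub> (fst r)"
            using that fw rP x by (metis G.inv_equality G.int_pow_closed G.inv_inv fst.hom_closed G.m_comm)
          then show ?thesis using subgroup.m_inv_closed[OF sf] r by auto
        qed
        moreover have "y [^]\<^bsub>H\<^esub> i \<in> snd ` R" if "snd w = \<one>\<^bsub>H\<^esub>"
        proof -
          have "y [^]\<^bsub>H\<^esub> i = inv\<^bsub>H\<^esub> (snd r)"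
            using that sw rP y by (metis H.inv_equality H.int_pow_closed H.inv_inv snd.hom_closed H.m_comm)
          then show ?thesis using subgroup.m_inv_closed[OF ss] r by auto
        qed
        ultimately show ?thesis by blast
      qed
    qed
    then have "graph R'"
      using sub' unfolding graph_def case_prod_unfold by blast
    moreover have "R \<subseteq> R'"
    proof
      fix r assume r: "r \<in> R"
      then have "r = r \<otimes>\<^bsub>?P\<^esub> \<one>\<^bsub>?P\<^esub>"
        using R.subset P.r_one[of r] by (metis subsetD)
      then show "r \<in> R'"
        using r subgroup.one_closed[OF gen] unfolding R'_def set_mult_def by blast
    qed
    moreover have "z \<in> R'"
    proof -
      have "z = \<one>\<^bsub>?P\<^esub> \<otimes>\<^bsub>?P\<^esub> z"
        using z P.l_one by metis
      then show ?thesis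
        using R.one_closed generate.incl[of z "{z}" ?P] unfolding R'_def set_mult_def by blast
    qed
    moreover have "z \<notin> R"
      using x by (force simp: z_def)
    ultimately show False using max[of R'] by blast
  qed
  have "fst \<in> iso (?P\<lparr>carrier := R\<rparr>) G" "snd \<in> iso (?P\<lparr>carrier := R\<rparr>) H"
    using inj surj group_hom.homh[OF fstR] group_hom.homh[OF sndR]
    by (auto simp: iso_def bij_betw_def)
  then show ?thesis
    using RG.iso_sym iso_trans unfolding is_iso_def by blast
qed

subsection \<open>Automorphisms\<close>

text \<open>The product in \<open>AutoGroup\<close> is composition restricted to the carrier, so on
  the carrier its powers are ordinary iterates.\<close>

lemma (in group) AutoGroup_pow_apply:
  assumes "\<phi> \<in> auto G" "x \<in> carrier G"
  shows "(\<phi> [^]\<^bsub>AutoGroup G\<^esub> (k::nat)) x = (\<phi> ^^ k) x"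
  using assms(2)
proof (induction k arbitrary: x)
  case 0
  then show ?case by (simp add: AutoGroup_def BijGroup_def)
next
  case (Suc k)
  interpret A: group "AutoGroup G" by (rule AutoGroup)
  have carr: "carrier (AutoGroup G) = auto G" by (simp add: AutoGroup_def)
  have "\<phi> [^]\<^bsub>AutoGroup G\<^esub> k \<in> auto G"
    using A.nat_pow_closed[of \<phi> k] assms(1) carr by simp
  then have "\<phi> [^]\<^bsub>AutoGroup G\<^esub> k \<in> Bij (carrier G)" "\<phi> \<in> Bij (carrier G)"
    using assms(1) by (auto simp: auto_def)
  moreover have "(f \<otimes>\<^bsub>AutoGroup G\<^esub> h) x = f (h x)"
    if "f \<in> Bij (carrier G)" "h \<in> Bij (carrier G)" for f h
    using that Suc.prems by (simp add: AutoGroup_def BijGroup_def compose_def)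
  ultimately have "(\<phi> [^]\<^bsub>AutoGroup G\<^esub> Suc k) x = (\<phi> [^]\<^bsub>AutoGroup G\<^esub> k) (\<phi> x)"
    by (simp only: A.nat_pow_Suc)
  moreover have "\<phi> x \<in> carrier G"
    using assms(1) Suc.prems by (auto simp: auto_def hom_def)
  ultimately show ?case
    using Suc.IH by (simp add: funpow_swap1)
qed

text \<open>Automorphisms are extensional, so agreement with the identity on the carrier makes the
  \<open>m\<close>-th power the unit; the order then divides \<open>m\<close> and inherits
  coprimality to \<open>p\<close>.\<close>

lemma (in group) p'_automorphismI:
  assumes \<phi>: "\<phi> \<in> auto G" and id: "\<And>x. x \<in> carrier G \<Longrightarrow> (\<phi> ^^ m) x = x" and m: "coprime m p"
  shows "p'_automorphism p G \<phi>"
proof -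
  interpret A: group "AutoGroup G" by (rule AutoGroup)
  have carr: "carrier (AutoGroup G) = auto G" by (simp add: AutoGroup_def)
  have "\<phi> [^]\<^bsub>AutoGroup G\<^esub> m \<in> extensional (carrier G)"
    using A.nat_pow_closed[of \<phi> m] \<phi> carr by (simp add: auto_def Bij_def)
  then have "\<phi> [^]\<^bsub>AutoGroup G\<^esub> m = (\<lambda>x\<in>carrier G. x)"
    by (rule extensionalityI[OF _ restrict_extensional]) (simp add: AutoGroup_pow_apply[OF \<phi>] id)
  then have "\<phi> [^]\<^bsub>AutoGroup G\<^esub> m = \<one>\<^bsub>AutoGroup G\<^esub>"
    by (simp add: AutoGroup_def BijGroup_def)
  then have ord: "group.ord (AutoGroup G) \<phi> dvd m"
    using A.pow_eq_id \<phi> carr by simp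
  show ?thesis
    unfolding p'_automorphism_def carr using \<phi> coprime_divisors[OF ord dvd_refl m] by (rule conjI)
qed

section \<open>The Singer cycle on an elementary abelian group\<close>

theorem theorem5p3:
  fixes p :: nat and V :: "('a, 'b) monoid_scheme"
  assumes "Factorial_Ring.prime p" and "elementary_abelian p V" and "order V > 2"
  shows "favorable p V"
proof -
  note p = assms(1)
  have pV: "p_group p V" and cV: "comm_group V"
    using assms(2) unfolding elementary_abelian_def by blast+
  then obtain n where n: "order V = p ^ n" unfolding p_group_def by blast
  have q: "1 < p ^ n" and q2: "2 < p ^ n" using assms(3) n by linarith+
  obtain K :: "((int list \<times> nat) multiset \<Rightarrow> int) ring"
    where K: "field K" and ordK: "order K = p ^ n" and char: "add_pow K p \<one>\<^bsub>K\<^esub> = \<zero>\<^bsub>K\<^esub>"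
    using exists_field_of_prime_power_order[OF p q] by auto
  interpret K: field K by (rule K)
  interpret V: comm_group V by (rule cV)
  have finK: "finite (carrier K)"
    using ordK q card_gt_0_iff[of "carrier K"] unfolding order_def by linarith
  have "elementary_abelian p (add_monoid K)"
    unfolding elementary_abelian_def p_group_def
    using p ordK finK K.a_comm_group K.a_group K.add_pow_char_eq_zero[OF char dvd_refl]
    by (auto simp: order_def add_pow_def)
  moreover have "order (add_monoid K) = order V"
    using ordK n by (simp add: order_def)
  ultimately obtain f where f: "f \<in> iso (add_monoid K) V"
    using elementary_abelian_iso[OF _ assms(2)] unfolding is_iso_def by blast
  define f' where "f' = inv_into (carrier K) f"
  have f': "f' \<in> iso V (add_monoid K)"
    using group.iso_set_sym[OF K.a_group f] by (simp add: f'_def)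
  have bij: "bij_betw f (carrier K) (carrier V)"
    using f by (simp add: iso_def)
  have fK: "f a \<in> carrier V" if "a \<in> carrier K" for a
    using bij that by (auto simp: bij_betw_def)
  have f'V: "f' x \<in> carrier K" if "x \<in> carrier V" for x
    using bij_betw_inv_into[OF bij] that by (auto simp: bij_betw_def f'_def)
  have ff': "f (f' x) = x" if "x \<in> carrier V" for x
    using bij that by (simp add: f'_def bij_betw_inv_into_right)
  have f'f: "f' (f a) = a" if "a \<in> carrier K" for a
    using bij that by (simp add: f'_def bij_betw_inv_into_left)
  have f_add: "f (a \<oplus>\<^bsub>K\<^esub> b) = f a \<otimes>\<^bsub>V\<^esub> f b" if "a \<in> carrier K" "b \<in> carrier K" for a b
    using f that by (auto simp: iso_def hom_def)
  have f'_mult: "f' (x \<otimes>\<^bsub>V\<^esub> y) = f' x \<oplus>\<^bsub>K\<^esub> f' y" if "x \<in> carrier V" "y \<in> carrier V" for x y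
    using f' that by (auto simp: iso_def hom_def)
  have f0: "f \<zero>\<^bsub>K\<^esub> = \<one>\<^bsub>V\<^esub>"
    using hom_one[of f "add_monoid K" V] f K.a_group V.is_group by (simp add: iso_def)

  let ?M = "Multiplicative_Group.mult_of K"
  obtain g where "g \<in> carrier ?M"
    and gen: "carrier ?M = {g [^]\<^bsub>K\<^esub> i | i::nat. i \<in> UNIV}"
    using K.finite_field_mult_group_has_gen[OF finK] by auto
  then have g: "g \<in> carrier K" "g \<noteq> \<zero>\<^bsub>K\<^esub>" by simp_all
  have ordM: "order ?M = p ^ n - 1"
    using K.order_mult_of[OF finK] ordK by simp
  \<comment> \<open>Since \<open>order V > 2\<close>, the group generated by \<open>g\<close> has
    more than one element. This is what makes \<open>\<phi>\<close> differ from the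
    identity.\<close>
  have g1: "g \<noteq> \<one>\<^bsub>K\<^esub>"
  proof
    assume "g = \<one>\<^bsub>K\<^esub>"
    then have "order ?M = 1"
      unfolding order_def gen by simp
    then show False using ordM q2 by linarith
  qed
  have gq: "g [^]\<^bsub>K\<^esub> (p ^ n - 1) = \<one>\<^bsub>K\<^esub>"
    using group.pow_order_eq_1[OF K.field_mult_group, of g] g ordM by (simp add: Multiplicative_Group.nat_pow_mult_of)

  \<comment> \<open>Multiplication by \<open>g\<close>, carried over to \<open>V\<close> along
    \<open>f\<close>; the restriction to the carrier makes it extensional, as membership in
    \<open>auto V\<close> requires.\<close>
  define \<phi> where "\<phi> = (\<lambda>x\<in>carrier V. f (g \<otimes>\<^bsub>K\<^esub> f' x))"
  have \<phi>V: "\<phi> x \<in> carrier V" if "x \<in> carrier V" for x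
    using that g f'V fK by (simp add: \<phi>_def)
  have \<phi>_pow: "(\<phi> ^^ k) x = f (g [^]\<^bsub>K\<^esub> k \<otimes>\<^bsub>K\<^esub> f' x)" if x: "x \<in> carrier V" for x k
  proof (induction k)
    case 0
    then show ?case using x f'V ff' by simp
  next
    case (Suc k)
    then show ?case
      using x g f'V fK by (simp add: \<phi>_def f'f K.m_ac)
  qed
  have \<phi>_id: "(\<phi> ^^ (p ^ n - 1)) x = x" if "x \<in> carrier V" for x
    using that by (simp only: \<phi>_pow gq K.l_one f'V ff')
  have "\<phi> \<in> hom V V"
    using \<phi>V g f'V fK by (auto simp: hom_def \<phi>_def f'_mult f_add K.r_distr)
  moreover have "bij_betw \<phi> (carrier V) (carrier V)"
  proof -
    \<comment> \<open>As \<open>\<phi> ^^ Suc m\<close> is the identity on \<open>V\<close>, the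
      iterate \<open>\<phi> ^^ m\<close> is the inverse of \<open>\<phi>\<close>.\<close>
    obtain m where m: "p ^ n - 1 = Suc m"
      using q2 that[of "p ^ n - 2"] by linarith
    have "(\<phi> ^^ m) x \<in> carrier V" if "x \<in> carrier V" for x
      using that \<phi>V by (induction m) auto
    moreover have "\<phi> ((\<phi> ^^ m) x) = x" "(\<phi> ^^ m) (\<phi> x) = x" if "x \<in> carrier V" for x
      using \<phi>_id[OF that] unfolding m by (simp_all add: funpow_swap1)
    ultimately show ?thesis
      using \<phi>V by (intro bij_betwI[where g = "\<phi> ^^ m"]) auto
  qed
  ultimately have \<phi>_auto: "\<phi> \<in> auto V"
    by (simp add: auto_def Bij_def \<phi>_def)
  \<comment> \<open>Consecutive numbers are coprime, and \<open>p\<close> divides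
    \<open>p ^ n\<close> because \<open>n\<close> is not 0.\<close>
  have cop: "coprime (p ^ n - 1) p"
  proof (rule coprime_divisors[OF dvd_refl])
    show "p dvd p ^ n" using q by (cases n) auto
    show "coprime (p ^ n - 1) (p ^ n)" using q by (intro coprime_diff_one_left_nat) linarith
  qed
  have "p'_automorphism p V \<phi>"
    by (rule V.p'_automorphismI[OF \<phi>_auto \<phi>_id cop])
  moreover have "\<phi> \<noteq> \<one>\<^bsub>AutoGroup V\<^esub>"
  proof
    assume "\<phi> = \<one>\<^bsub>AutoGroup V\<^esub>"
    then have "\<phi> (f \<one>\<^bsub>K\<^esub>) = f \<one>\<^bsub>K\<^esub>"
      using fK by (simp add: AutoGroup_def BijGroup_def)
    then have "f g = f \<one>\<^bsub>K\<^esub>"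
      using g fK by (simp add: \<phi>_def f'f)
    then show False
      using g g1 f'f by (metis K.one_closed)
  qed
  moreover have "\<phi> h = h" if H: "subgroup H V" "H \<noteq> carrier V" "\<phi> ` H = H" and h: "h \<in> H" for H h
  proof (cases "f' h = \<zero>\<^bsub>K\<^esub>")
    case True
    then show ?thesis
      using subgroup.mem_carrier[OF H(1) h] g ff'[of h] by (simp add: \<phi>_def)
  next
    case False
    have hV: "h \<in> carrier V" using subgroup.mem_carrier[OF H(1) h] .
    have pow: "(\<phi> ^^ k) h \<in> H" for k
      using h H(3) by (induction k) auto
    \<comment> \<open>A non-identity \<open>h\<close> in \<open>H\<close> would force
      \<open>H\<close> to be all of \<open>V\<close>: the quotient of \<open>f' y\<close> by
      \<open>f' h\<close> is a power of \<open>g\<close>, so \<open>y\<close> lies in the orbit of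
      \<open>h\<close> under \<open>\<phi>\<close>.\<close>
    have "y \<in> H" if y: "y \<in> carrier V" for y
    proof (cases "f' y = \<zero>\<^bsub>K\<^esub>")
      case True
      then show ?thesis
        using ff'[OF y] f0 subgroup.one_closed[OF H(1)] by simp
    next
      case nz: False
      have U: "f' h \<in> Units K" "f' y \<in> Units K"
        using False nz f'V[OF hV] f'V[OF y] K.field_Units by auto
      then have "f' y \<otimes>\<^bsub>K\<^esub> inv\<^bsub>K\<^esub> f' h \<in> carrier ?M"
        using K.field_Units by (metis K.Units_inv_Units K.Units_m_closed Multiplicative_Group.carrier_mult_of)
      then obtain i :: nat where "f' y \<otimes>\<^bsub>K\<^esub> inv\<^bsub>K\<^esub> f' h = g [^]\<^bsub>K\<^esub> i"
        unfolding gen by auto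
      then have "g [^]\<^bsub>K\<^esub> i \<otimes>\<^bsub>K\<^esub> f' h = f' y"
        using U by (metis K.Units_closed K.Units_inv_closed K.Units_l_inv K.m_assoc K.r_one)
      then have "y = (\<phi> ^^ i) h"
        using \<phi>_pow[OF hV] ff'[OF y] by simp
      then show ?thesis using pow by simp
    qed
    then show ?thesis
      using H subgroup.subset by blast
  qed
  ultimately show ?thesis
    using pV unfolding favorable_def by blast
qed

end
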